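(* Let $\ell\in\mathbb{Z}$. Then for all integers $n\ge 0$: (a) for every integer $m\ge 1$, $$(N-2)\,F_m(N,-1)\,A_n(2,2m,\ell,1)=0;$$ (b) for every integer $m\ge 0$, $$\left(L_{m+1}(N,-1)-L_m(N,-1)\right)A_n(2,2m+1,\ell,1)=0.$$
   Context: For integers $n\ge 0$, $k\ge1$, $m\ge 1$, $\ell\in\mathbb{Z}$ and nonzero complex $z$, define $$A_n(k,m,\ell,z)=\sum_{h\in\mathbb{Z}}\binom{n}{\left\lfloor \frac{n+mh+\ell}{k}\right\rfloor}z^h,$$ where $\binom{n}{r}=0$ for $r<0$ or $r>n$ (so the sum is finite). The Fibonacci polynomials are defined by $F_0(x,s)=0$, $F_1(x,s)=1$ and $F_n(x,s)=xF_{n-1}(x,s)+sF_{n-2}(x,s)$ for $n\ge2$. The Lucas polynomials are defined by $L_0(x,s)=2$, $L_1(x,s)=x$ and $L_n(x,s)=xL_{n-1}(x,s)+sL_{n-2}(x,s)$ for $n\ge2$. $N$ denotes the shift operator on sequences in the index $n$: $N^iA_n=A_{n+i}$; for a polynomial $p(t)=\sum_i c_it^i$ one has $p(N)A_n=\sum_i c_iA_{n+i}$, and products of polynomials in $N$ act by composition. *)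

theory Defs
  imports
    Complex_Main
    "HOL-Library.Groups_Big_Fun"
    "HOL-Computational_Algebra.Polynomial"
begin

definition int_binomial :: "nat \<Rightarrow> int \<Rightarrow> nat" where
  "int_binomial n r = (if r < 0 then 0 else n choose nat r)"

text \<open>\<open>Sum_any\<close> is the sum over the support of its argument, which is finite for
  \<open>k, m \<ge> 1\<close> (lemma \<open>finite_support_binom_sum\<close>); for infinite support it would be \<open>0\<close>.\<close>

definition binom_sum :: "nat \<Rightarrow> nat \<Rightarrow> nat \<Rightarrow> int \<Rightarrow> complex \<Rightarrow> complex" where
  "binom_sum n k m l z =
     Sum_any (\<lambda>h::int.
       of_nat (int_binomial n \<lfloor>(real n + real m * real_of_int h + real_of_int l) / real k\<rfloor>) * z powi h)"

lemma finite_support_binom_sum: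
  fixes l :: int and z :: complex
  assumes "k \<ge> 1" "m \<ge> 1"
  shows "finite {h::int. of_nat (int_binomial n
           \<lfloor>(real n + real m * real_of_int h + real_of_int l) / real k\<rfloor>) * z powi h \<noteq> 0}"
proof (rule finite_subset)
  show "finite {- int n - \<bar>l\<bar> .. int k * (int n + 1) + \<bar>l\<bar>}" by simp
  show "{h::int. of_nat (int_binomial n
           \<lfloor>(real n + real m * real_of_int h + real_of_int l) / real k\<rfloor>) * z powi h \<noteq> 0}
        \<subseteq> {- int n - \<bar>l\<bar> .. int k * (int n + 1) + \<bar>l\<bar>}"
  proof
    fix h :: int
    define t where "t = int n + int m * h + l"
    have t: "\<lfloor>(real n + real m * real_of_int h + real_of_int l) / real k\<rfloor> = t div int k"
      unfolding t_def using floor_divide_of_int_eq[of "int n + int m * h + l" "int k", where 'a = real]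
      by simp
    assume "h \<in> {h::int. of_nat (int_binomial n
           \<lfloor>(real n + real m * real_of_int h + real_of_int l) / real k\<rfloor>) * z powi h \<noteq> 0}"
    then have "int_binomial n \<lfloor>(real n + real m * real_of_int h + real_of_int l) / real k\<rfloor> \<noteq> 0"
      by (metis (mono_tags, lifting) mem_Collect_eq mult_zero_left of_nat_0)
    then have "int_binomial n (t div int k) \<noteq> 0"
      unfolding t .
    then have r: "0 \<le> t div int k" "t div int k \<le> int n"
      by (auto simp: int_binomial_def not_less split: if_splits)
    have t0: "0 \<le> t"
      using r(1) assms(1) by (simp add: pos_imp_zdiv_nonneg_iff)
    have "t = int k * (t div int k) + t mod int k" by simp
    also have "\<dots> \<le> int k * int n + int k"
      using r(2) assms(1) by (intro add_mono mult_left_mono) (auto intro: less_imp_le)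
    finally have t1: "t \<le> int k * (int n + 1)" by (simp add: algebra_simps)
    have lo: "- int n - \<bar>l\<bar> \<le> h"
    proof (cases "h \<ge> 0")
      case False
      then have "int m * h \<le> 1 * h" using assms(2) by (intro mult_right_mono_neg) auto
      then show ?thesis using t0 unfolding t_def by linarith
    qed linarith
    have hi: "h \<le> int k * (int n + 1) + \<bar>l\<bar>"
    proof (cases "h \<ge> 0")
      case True
      then have "1 * h \<le> int m * h" using assms(2) by (intro mult_right_mono) auto
      then show ?thesis using t1 unfolding t_def by linarith
    next
      case False
      moreover have "0 \<le> int k * (int n + 1)" by simp
      ultimately show ?thesis by linarith
    qed
    show "h \<in> {- int n - \<bar>l\<bar> .. int k * (int n + 1) + \<bar>l\<bar>}"
      using lo hi by simp
  qed
qed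

fun fib_poly :: "nat \<Rightarrow> 'a::comm_ring_1 \<Rightarrow> 'a \<Rightarrow> 'a" where
  "fib_poly 0 x s = 0"
| "fib_poly (Suc 0) x s = 1"
| "fib_poly (Suc (Suc n)) x s = x * fib_poly (Suc n) x s + s * fib_poly n x s"

fun lucas_poly :: "nat \<Rightarrow> 'a::comm_ring_1 \<Rightarrow> 'a \<Rightarrow> 'a" where
  "lucas_poly 0 x s = 2"
| "lucas_poly (Suc 0) x s = x"
| "lucas_poly (Suc (Suc n)) x s = x * lucas_poly (Suc n) x s + s * lucas_poly n x s"

definition seq_shift :: "(nat \<Rightarrow> 'a) \<Rightarrow> nat \<Rightarrow> 'a" where
  "seq_shift A n = A (n + 1)"

text \<open>\<open>shift_operator p\<close> is the operator \<open>p(N)\<close>, where \<open>N\<close> is \<open>seq_shift\<close>. The polynomials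
  \<open>F\<^sub>m(t, s)\<close> and \<open>L\<^sub>m(t, s)\<close> in an indeterminate \<open>t\<close> are obtained from \<open>fib_poly\<close> and
  \<open>lucas_poly\<close> over the ring of polynomials, with \<open>x = [:0, 1:]\<close>.\<close>

definition shift_operator :: "'a::comm_ring_1 poly \<Rightarrow> (nat \<Rightarrow> 'a) \<Rightarrow> nat \<Rightarrow> 'a" where
  "shift_operator p A n = (\<Sum>i\<le>degree p. coeff p i * (seq_shift ^^ i) A n)"

end

theory Submission
  imports Defs
begin

text \<open>
  Pascal's rule turns the shift \<open>N\<close> in \<open>n\<close> into \<open>E + E\<^sup>-\<^sup>1\<close>, where \<open>E\<close> is the shift in \<open>\<ell>\<close>; hence
  \<open>L\<^sub>m(N, -1) = E\<^sup>m + E\<^sup>-\<^sup>m\<close> and \<open>F\<^sub>m(N, -1) = (E\<^sup>m - E\<^sup>-\<^sup>m) / (E - E\<^sup>-\<^sup>1)\<close>. For \<open>z = 1\<close> the sums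
  have period \<open>M\<close> in \<open>\<ell>\<close>, where \<open>M\<close> is \<open>2m\<close> in (a) and \<open>2m + 1\<close> in (b). For \<open>M = 2m + 1\<close> the four terms of
  \<open>(E\<^sup>m\<^sup>+\<^sup>1 + E\<^sup>-\<^sup>m\<^sup>-\<^sup>1) - (E\<^sup>m + E\<^sup>-\<^sup>m)\<close> cancel in pairs. For \<open>M = 2m\<close> applying \<open>F\<^sub>m(N, -1)\<close> sums over
  one parity class of residues modulo \<open>2m\<close>, and the symmetry \<open>\<ell> \<mapsto> 1 - \<ell>\<close> of the binomial coefficients
  exchanges the two classes; so the result is constant in \<open>\<ell>\<close>, where \<open>N\<close> acts as multiplication by \<open>2\<close>.
\<close>

lemma int_binomial_Suc:
  "int_binomial (Suc n) r = int_binomial n r + int_binomial n (r - 1)"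
proof (cases "r \<le> 0")
  case False
  then obtain k where "r = int (Suc k)"
    by (metis not_le pos_int_cases Suc_pred)
  then show ?thesis by (simp add: int_binomial_def nat_add_distrib)
qed (auto simp: int_binomial_def)

lemma int_binomial_symmetric: "int_binomial n (int n - r) = int_binomial n r"
proof (cases "0 \<le> r \<and> r \<le> int n")
  case True
  then have "nat (int n - r) = n - nat r" "nat r \<le> n" by auto
  with True show ?thesis by (simp add: int_binomial_def binomial_symmetric[symmetric])
qed (auto simp: int_binomial_def)

lemma floor_binom_arg:
  "\<lfloor>(real n + real m * real_of_int h + real_of_int l) / real k\<rfloor> = (int n + int m * h + l) div int k"
  using floor_divide_of_int_eq[of "int n + int m * h + l" "int k", where 'a = real] by simp

lemma binom_sum_div:
  "binom_sum n k m l z =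
     Sum_any (\<lambda>h. of_nat (int_binomial n ((int n + int m * h + l) div int k)) * z powi h)"
  by (simp add: binom_sum_def floor_binom_arg)

text \<open>Lowering the lower index of the binomial coefficient by one amounts to lowering
  \<open>l\<close> by \<open>k\<close>. For \<open>k = 2\<close> the shifts of \<open>l\<close> are
  +1 and -1.\<close>

lemma binom_sum_Suc:
  assumes "k \<ge> 1" "m \<ge> 1"
  shows "binom_sum (Suc n) k m l z = binom_sum n k m (l + 1) z + binom_sum n k m (l + 1 - int k) z"
proof -
  define f where "f = (\<lambda>n l h. of_nat (int_binomial n ((int n + int m * h + l) div int k)) * z powi h)"
  have fin: "finite {h. f n l h \<noteq> 0}" for n l
    using finite_support_binom_sum[OF assms, of n l z] by (simp only: f_def floor_binom_arg)
  have "f (Suc n) l h = f n (l + 1) h + f n (l + 1 - int k) h" for h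
  proof -
    define t where "t = int n + int m * h + (l + 1)"
    have "t + (- 1) * int k = int n + int m * h + (l + 1 - int k)" "t = int (Suc n) + int m * h + l"
      by (simp_all add: t_def)
    moreover have "(t + (- 1) * int k) div int k = t div int k - 1"
      using assms(1) by (subst div_mult_self1) simp_all
    ultimately show ?thesis
      by (metis (no_types, lifting) f_def t_def int_binomial_Suc of_nat_add distrib_right)
  qed
  then have "Sum_any (f (Suc n) l) = Sum_any (f n (l + 1)) + Sum_any (f n (l + 1 - int k))"
    by (simp add: Sum_any.distrib[OF fin fin, symmetric])
  then show ?thesis by (simp only: binom_sum_div f_def)
qed

lemma binom_sum_periodic: "binom_sum n k m (l + int m) 1 = binom_sum n k m l 1"
  unfolding binom_sum_div
  by (rule Sum_any.reindex_cong[symmetric, of "\<lambda>h. h + 1"])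
    (auto simp: fun_eq_iff algebra_simps intro: o_bij[of "\<lambda>h. h - 1"])

text \<open>After h \<mapsto> -h the two numerators add up to the odd number 2n + 1, so their
  halves, rounded down, add up to n.\<close>

lemma binom_sum_reflect: "binom_sum n 2 m (1 - l) 1 = binom_sum n 2 m l 1"
proof -
  have "int_binomial n ((int n + int m * h + (1 - l)) div 2) =
    int_binomial n ((int n + int m * (- h) + l) div 2)" for h
  proof -
    have "(int n + int m * h + (1 - l)) div 2 = int n - (int n + int m * (- h) + l) div 2"
      by simp
    then show ?thesis by (simp only: int_binomial_symmetric)
  qed
  then show ?thesis
    unfolding binom_sum_div
    by (intro Sum_any.reindex_cong[symmetric, of uminus]) (auto simp: fun_eq_iff bij_uminus)
qed

lemma seq_shift_funpow: "(seq_shift ^^ i) A n = A (n + i)"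
  by (induction i arbitrary: n) (simp_all add: seq_shift_def)

text \<open>A common bound \<open>d\<close> lets operators of different degrees be compared term by
  term.\<close>

lemma shift_operator_sum:
  assumes "degree p \<le> d"
  shows "shift_operator p A n = (\<Sum>i\<le>d. coeff p i * A (n + i))"
  unfolding shift_operator_def seq_shift_funpow
  using assms by (intro sum.mono_neutral_left) (auto simp: coeff_eq_0)

lemma shift_operator_0 [simp]: "shift_operator 0 A n = 0"
  by (simp add: shift_operator_def)

text \<open>The factor \<open>[:0, 1:]\<close> in the recurrences simplifies to
  \<open>pCons 0\<close>, which this rule turns into a shift of \<open>n\<close>.\<close>

lemma shift_operator_pCons [simp]:
  "shift_operator (pCons c p) A n = c * A n + shift_operator p A (Suc n)"
proof -
  have "shift_operator (pCons c p) A n = (\<Sum>i\<le>Suc (degree p). coeff (pCons c p) i * A (n + i))"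
    by (intro shift_operator_sum degree_pCons_le)
  then show ?thesis
    by (subst (asm) sum.atMost_Suc_shift) (simp add: shift_operator_sum[of p "degree p"])
qed

lemma shift_operator_diff:
  "shift_operator (p - q) A n = shift_operator p A n - shift_operator q A n"
proof -
  define d where "d = max (degree p) (degree q)"
  have "degree p \<le> d" "degree q \<le> d" "degree (p - q) \<le> d"
    by (auto simp: d_def intro: degree_diff_le)
  then show ?thesis
    by (simp add: shift_operator_sum[of _ d] left_diff_distrib sum_subtractf)
qed

lemma shift_operator_lucas_poly:
  fixes B :: "nat \<Rightarrow> int \<Rightarrow> 'a::comm_ring_1"
  assumes B: "\<And>n t. B (Suc n) t = B n (t + 1) + B n (t - 1)"
  shows "shift_operator (lucas_poly m [:0, 1:] (- 1)) (\<lambda>j. B j l) n = B n (l + int m) + B n (l - int m)"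
proof (induction m arbitrary: n rule: induct_nat_012)
  case 0
  \<comment> \<open>The constant coefficient of the polynomial 2 is computed as its value at
    0.\<close>
  show ?case by (simp add: shift_operator_sum[of _ 0] flip: poly_0_coeff_0)
next
  case 1
  show ?case by (simp add: B)
next
  case (ge2 m)
  show ?case
    by (simp add: shift_operator_diff ge2 B) (simp add: algebra_simps)
qed

text \<open>The quotient of E-powers is written out as the geometric sum of E^(m-1-2j) over j < m,
  which avoids division.\<close>

lemma shift_operator_fib_poly:
  fixes B :: "nat \<Rightarrow> int \<Rightarrow> 'a::comm_ring_1"
  assumes B: "\<And>n t. B (Suc n) t = B n (t + 1) + B n (t - 1)"
  shows "shift_operator (fib_poly m [:0, 1:] (- 1)) (\<lambda>j. B j l) n =
    (\<Sum>j<m. B n (l + int m - 1 - 2 * int j))"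
proof (induction m arbitrary: n rule: induct_nat_012)
  case 1
  show ?case by (simp add: shift_operator_sum[of _ 0])
next
  case (ge2 m)
  show ?case
    by (simp add: shift_operator_diff ge2 B sum.distrib) (simp add: algebra_simps)
qed simp

lemma periodic_int_multiple:
  fixes f :: "int \<Rightarrow> 'a"
  assumes "\<And>t. f (t + p) = f t"
  shows "f (t + p * i) = f t"
proof (induction i rule: int_induct[of _ 0])
  case (step1 i)
  then show ?case using assms[of "t + p * i"] by (simp add: algebra_simps)
next
  case (step2 i)
  then show ?case using assms[of "t + p * (i - 1)"] by (simp add: algebra_simps)
qed simp

lemma shift_operator_fib_poly_annihilates:
  fixes B :: "nat \<Rightarrow> int \<Rightarrow> 'a::comm_ring_1"
  assumes B: "\<And>n t. B (Suc n) t = B n (t + 1) + B n (t - 1)"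
    and periodic: "\<And>n t. B n (t + 2 * int m) = B n t"
    and reflect: "\<And>n t. B n (1 - t) = B n t"
  shows "shift_operator [:-2, 1:] (shift_operator (fib_poly m [:0, 1:] (- 1)) (\<lambda>j. B j l)) n = 0"
proof -
  define S where "S n t = (\<Sum>j<m. B n (t + int m - 1 - 2 * int j))" for n t
  have S2: "S n (t + 2) = S n t" for n t
  proof -
    \<comment> \<open>The difference telescopes to two terms whose arguments are one period 2m
      apart.\<close>
    have "S n (t + 2) - S n t =
      (\<Sum>j<m. B n (t + int m + 1 - 2 * int j) - B n (t + int m + 1 - 2 * int (Suc j)))"
      by (simp add: S_def sum_subtractf algebra_simps)
    also have "\<dots> = B n (t + int m + 1) - B n (t + int m + 1 - 2 * int m)"
      by (subst sum_lessThan_telescope') simp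
    also have "\<dots> = 0"
      using periodic[of n "t + int m + 1 - 2 * int m"] by (simp add: algebra_simps)
    finally show ?thesis by simp
  qed
  have S1: "S n (t + 1) = S n t" for n t
  proof -
    have "S n (t + 1) = (\<Sum>j<m. B n (1 - (t + int m - 2 * int j)))"
      by (simp add: S_def reflect)
    \<comment> \<open>The reflected arguments run upwards in j; reversing the sum matches them with
      those of \<open>S n (- t)\<close>.\<close>
    also have "\<dots> = (\<Sum>j<m. B n (1 - (t + int m - 2 * int (m - Suc j))))"
      by (rule sum.nat_diff_reindex[symmetric])
    also have "\<dots> = S n (- t)"
      unfolding S_def by (intro sum.cong refl) (simp add: of_nat_diff algebra_simps)
    \<comment> \<open>The arguments -t and t have the same parity, so period 2 suffices.\<close>
    also have "\<dots> = S n (- t + 2 * t)"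
      by (rule periodic_int_multiple[symmetric]) (rule S2)
    finally show ?thesis by simp
  qed
  have "S (Suc n) l = S n (l + 1) + S n (l - 1)"
    by (simp add: S_def B sum.distrib algebra_simps)
  also have "\<dots> = 2 * S n l"
    using S1[of n l] S1[of n "l - 1"] by simp
  finally show ?thesis
    by (simp add: shift_operator_fib_poly[of B, OF B] S_def)
qed

lemma shift_operator_lucas_poly_annihilates:
  fixes B :: "nat \<Rightarrow> int \<Rightarrow> 'a::comm_ring_1"
  assumes B: "\<And>n t. B (Suc n) t = B n (t + 1) + B n (t - 1)"
    and periodic: "\<And>n t. B n (t + int (2 * m + 1)) = B n t"
  shows "shift_operator (lucas_poly (m + 1) [:0, 1:] (- 1) - lucas_poly m [:0, 1:] (- 1))
    (\<lambda>j. B j l) n = 0"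
  \<comment> \<open>One period takes l - m to l + m + 1 and l - m - 1 to l + m: these are the
    cancelling pairs.\<close>
  using periodic[of n "l - int m"] periodic[of n "l - int m - 1"]
  by (simp add: shift_operator_diff shift_operator_lucas_poly[of B, OF B] algebra_simps)

theorem theorem5:
  fixes l :: int and n :: nat
  shows "(\<forall>m::nat. m \<ge> 1 \<longrightarrow>
            shift_operator [:-2, 1:]
              (shift_operator (fib_poly m [:0, 1:] (-1)) (\<lambda>j. binom_sum j 2 (2 * m) l 1)) n = 0)
       \<and> (\<forall>m::nat.
            shift_operator (lucas_poly (m + 1) [:0, 1:] (-1) - lucas_poly m [:0, 1:] (-1))
              (\<lambda>j. binom_sum j 2 (2 * m + 1) l 1) n = 0)"
proof (intro conjI allI impI)
  have pascal: "binom_sum (Suc n) 2 M t 1 = binom_sum n 2 M (t + 1) 1 + binom_sum n 2 M (t - 1) 1"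
    if "M \<ge> 1" for n M t
    using binom_sum_Suc[of 2 M n t 1] that by simp
  fix m :: nat
  show "shift_operator [:-2, 1:]
      (shift_operator (fib_poly m [:0, 1:] (-1)) (\<lambda>j. binom_sum j 2 (2 * m) l 1)) n = 0" if "m \<ge> 1"
    using that binom_sum_periodic[of _ 2 "2 * m"]
    by (intro shift_operator_fib_poly_annihilates pascal binom_sum_reflect) simp_all
  show "shift_operator (lucas_poly (m + 1) [:0, 1:] (-1) - lucas_poly m [:0, 1:] (-1))
      (\<lambda>j. binom_sum j 2 (2 * m + 1) l 1) n = 0"
    by (intro shift_operator_lucas_poly_annihilates pascal binom_sum_periodic) simp
qed

end
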